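(* Let $n\ge 1$ and let $K_{1,n}$ be the star with $n$ leaves. Then $\chi_g^{\infty2}(K_{1,n})=3$ when $n$ is odd, and $\chi_g^{\infty2}(K_{1,n})=4$ when $n \geq 4$ is even.
   Context: The eternal vertex coloring game (A-game) on a finite undirected graph $G$ with color set $\{1,\ldots,k\}$: all vertices are initially uncolored. Alice and Bob strictly alternate turns, Alice moving first overall. On a turn the player chooses one vertex. If it is uncolored, the player must give it a color not currently used on any of its neighbors; if it currently has color $c$, the player must change its color to a color different from $c$ that is not currently used on any of its neighbors. The player whose turn it is picks the vertex and the new color. Play proceeds in rounds: every vertex must be chosen $t$ times before any vertex is chosen $t+1$ times, for every integer $t\ge 1$ (so each vertex is chosen exactly once per round; turns keep alternating across rounds, so if $|V(G)|$ is odd Bob moves first in even-numbered rounds). If some player chooses a vertex $v$ (still available in the current round) that cannot be legally colored, i.e. every color in the color set other than the current color of $v$ (if any) appears on a neighbor of $v$, then Bob wins. In particular Bob may deliberately choose such a vertex. Alice wins if this never happens (the game goes on forever). The (eternal) Greedy Coloring Game is the same game with one additional restriction on Bob: Bob must color or re-color whatever vertex he chooses with the smallest legal color (the smallest integer in $\{1,\ldots,k\}$ different from the vertex's current color, if any, and not used on any of its neighbors). Alice may use any legal color. $\chi_g^{\infty2}(G)$ denotes the minimum $k$ such that Alice has a winning strategy in this eternal game on $G$ with $k$ colors. *)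

theory Defs
  imports "Graph_Theory.Kuratowski"
begin

text \<open>
  Graphs are the symmetric digraphs of the locale \<^locale>\<open>graph\<close>; the neighbours of \<open>v\<close> are the
  vertices \<open>u\<close> with \<open>v \<rightarrow>\<^bsub>G\<^esub> u\<close>.

  A history lists the moves (vertex, new color) made so far, most recent move first. Hence
  \<open>map_of h v\<close> is the current color of \<open>v\<close> (\<open>None\<close> if it is still uncolored), and since Alice
  starts and turns alternate across rounds, Alice is to move iff \<open>length h\<close> is even.
\<close>

type_synonym 'a history = "('a \<times> nat) list"

definition times_chosen :: "'a history \<Rightarrow> 'a \<Rightarrow> nat" where
  "times_chosen h v = count_list (map fst h) v"

text \<open>
  Every vertex must be chosen \<open>t\<close> times before any vertex is chosen \<open>t + 1\<close> times: \<open>v\<close> may be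
  chosen iff no vertex has been chosen fewer times than \<open>v\<close>.
\<close>

definition available :: "('a, 'b) pre_digraph \<Rightarrow> 'a history \<Rightarrow> 'a \<Rightarrow> bool" where
  "available G h v \<longleftrightarrow>
     v \<in> verts G \<and> (\<forall>u \<in> verts G. times_chosen h v \<le> times_chosen h u)"

definition legal_color ::
  "('a, 'b) pre_digraph \<Rightarrow> nat \<Rightarrow> 'a history \<Rightarrow> 'a \<Rightarrow> nat \<Rightarrow> bool" where
  "legal_color G k h v c \<longleftrightarrow>
     c \<in> {1..k} \<and> map_of h v \<noteq> Some c \<and> (\<forall>u. v \<rightarrow>\<^bsub>G\<^esub> u \<longrightarrow> map_of h u \<noteq> Some c)"

definition colorable ::
  "('a, 'b) pre_digraph \<Rightarrow> nat \<Rightarrow> 'a history \<Rightarrow> 'a \<Rightarrow> bool" where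
  "colorable G k h v \<longleftrightarrow> (\<exists>c. legal_color G k h v c)"

definition greedy_color ::
  "('a, 'b) pre_digraph \<Rightarrow> nat \<Rightarrow> 'a history \<Rightarrow> 'a \<Rightarrow> nat" where
  "greedy_color G k h v = (LEAST c. legal_color G k h v c)"

text \<open>
  The histories that can arise when Alice follows the strategy \<open>\<sigma>\<close> and Bob plays arbitrarily,
  subject to the rules and to the greedy restriction on his colors. A history is not extended by a
  choice of an uncolorable vertex, as that choice ends the game.
\<close>

inductive greedy_play ::
  "('a, 'b) pre_digraph \<Rightarrow> nat \<Rightarrow> ('a history \<Rightarrow> 'a \<times> nat) \<Rightarrow> 'a history \<Rightarrow> bool"
  for G k \<sigma> where
  start: "greedy_play G k \<sigma> []"
| alice: "greedy_play G k \<sigma> ((v, c) # h)"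
    if "greedy_play G k \<sigma> h" "even (length h)"
      "\<sigma> h = (v, c)" "available G h v" "legal_color G k h v c"
| bob: "greedy_play G k \<sigma> ((v, greedy_color G k h v) # h)"
    if "greedy_play G k \<sigma> h" "odd (length h)"
      "available G h v" "colorable G k h v"

text \<open>
  Alice wins with \<open>\<sigma>\<close> iff \<open>\<sigma>\<close> always prescribes an available vertex together with a legal color for
  it, and Bob never gets the opportunity to choose an available uncolorable vertex.
\<close>

definition winning_greedy_strategy ::
  "('a, 'b) pre_digraph \<Rightarrow> nat \<Rightarrow> ('a history \<Rightarrow> 'a \<times> nat) \<Rightarrow> bool" where
  "winning_greedy_strategy G k \<sigma> \<longleftrightarrow>
     (\<forall>h. greedy_play G k \<sigma> h \<longrightarrow>
        (if even (length h)
         then (case \<sigma> h of (v, c) \<Rightarrow> available G h v \<and> legal_color G k h v c)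
         else (\<forall>v. available G h v \<longrightarrow> colorable G k h v)))"

definition alice_wins_greedy :: "('a, 'b) pre_digraph \<Rightarrow> nat \<Rightarrow> bool" where
  "alice_wins_greedy G k \<longleftrightarrow> (\<exists>\<sigma>. winning_greedy_strategy G k \<sigma>)"

definition eternal_greedy_game_chromatic_number ::
  "('a, 'b) pre_digraph \<Rightarrow> nat" (\<open>\<chi>\<^sub>g\<^sup>\<infinity>\<^sup>2\<close>) where
  "\<chi>\<^sub>g\<^sup>\<infinity>\<^sup>2 G = (LEAST k. alice_wins_greedy G k)"

end

theory Submission
  imports Defs
begin

text \<open>
  Alice recolors the center as soon as it is available and otherwise colors any available leaf
  greedily. If \<open>n\<close> is odd she opens every round, and with three colors the color of a leaf is then
  forced by the new color of the center, so each round ends with equally colored leaves. If \<open>n\<close> is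
  even and there are four colors, she gives the center color 3 or 4 in the rounds that she opens;
  the leaves then all get color 1 or 2. When Bob opens the next round by recoloring a leaf, its new
  color is the other one of 1 and 2, so that the fourth color is free for the center, and the
  remaining leaves follow the first one. When he opens with the center, it gets the other one of 1
  and 2, the leaves get color 3, and Alice moves the center to 4.

  For the lower bounds, a complete first round is a proper coloring, and the next move needs a third
  color. If \<open>n\<close> is even, Bob makes that move; with three colors he can then produce leaves of two
  different colors while the center is still available.
\<close>

section \<open>Rounds\<close>

text \<open>
  In round \<open>m\<close>, counted from 0, exactly the vertices in \<open>S\<close> have been chosen. As \<open>S\<close> is a proper
  subset, a completed round \<open>m\<close> is recorded as round \<open>m + 1\<close> with \<open>S = {}\<close>.
\<close>

definition round_state :: "('a, 'b) pre_digraph \<Rightarrow> 'a history \<Rightarrow> nat \<Rightarrow> 'a set \<Rightarrow> bool" where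
  "round_state G h m S \<longleftrightarrow>
     S \<subset> verts G \<and> length h = m * card (verts G) + card S \<and>
     (\<forall>v \<in> verts G. times_chosen h v = m + of_bool (v \<in> S))"

lemma times_chosen_Nil [simp]: "times_chosen [] v = 0"
  by (simp add: times_chosen_def)

lemma times_chosen_Cons [simp]:
  "times_chosen ((u, c) # h) v = times_chosen h v + of_bool (u = v)"
  by (simp add: times_chosen_def)

lemma map_of_eq_None_iff_times_chosen: "map_of h v = None \<longleftrightarrow> times_chosen h v = 0"
  by (simp add: times_chosen_def map_of_eq_None_iff count_list_0_iff)

lemma round_state_Nil: "verts G \<noteq> {} \<Longrightarrow> round_state G [] 0 {}"
  by (auto simp: round_state_def)

text \<open>As \<open>S\<close> is a proper subset, some vertex has been chosen only
  \<open>m\<close> times, so \<open>m\<close> is the least count.\<close>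

lemma available_round_state:
  assumes "round_state G h m S"
  shows "available G h v \<longleftrightarrow> v \<in> verts G - S"
proof -
  obtain w where "w \<in> verts G" "w \<notin> S"
    using assms by (auto simp: round_state_def)
  moreover have "times_chosen h u = m + of_bool (u \<in> S)" if "u \<in> verts G" for u
    using assms that by (simp add: round_state_def)
  ultimately show ?thesis
    by (auto simp: available_def)
qed

lemma round_state_Cons:
  assumes "finite (verts G)" "round_state G h m S" "v \<in> verts G - S"
  shows "round_state G ((v, c) # h) m (insert v S) \<or>
    insert v S = verts G \<and> round_state G ((v, c) # h) (Suc m) {}"
proof -
  have v: "v \<in> verts G" "v \<notin> S" using assms(3) by auto
  have nonempty: "{} \<subset> verts G" using v by blast
  have S: "S \<subset> verts G" and len: "length h = m * card (verts G) + card S"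
    and times: "\<And>u. u \<in> verts G \<Longrightarrow> times_chosen h u = m + of_bool (u \<in> S)"
    using assms by (auto simp: round_state_def)
  have card: "card (insert v S) = Suc (card S)"
    using v S assms(1) by (meson card_insert_disjoint finite_subset psubset_imp_subset)
  show ?thesis
  proof (cases "insert v S = verts G")
    case True
    then have "times_chosen ((v, c) # h) u = Suc m" if "u \<in> verts G" for u
      using that times[OF that] v True by (cases "u = v") auto
    then show ?thesis
      using True card len nonempty by (simp add: round_state_def)
  next
    case False
    then show ?thesis
      using card len v S times by (auto simp: round_state_def)
  qed
qed

section \<open>Plays\<close>

lemma greedy_play_round_state:
  assumes "greedy_play G k \<sigma> h" "finite (verts G)" "verts G \<noteq> {}"
  shows "\<exists>m S. round_state G h m S"
  using assms(1)
proof induction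
  case start
  show ?case using round_state_Nil[OF assms(3)] by blast
next
  case (alice h v c)
  then obtain m S where rs: "round_state G h m S" by blast
  moreover have "v \<in> verts G - S"
    using available_round_state[OF rs] alice.hyps by blast
  ultimately show ?case using round_state_Cons[OF assms(2)] by blast
next
  case (bob h v)
  then obtain m S where rs: "round_state G h m S" by blast
  moreover have "v \<in> verts G - S"
    using available_round_state[OF rs] bob.hyps by blast
  ultimately show ?case using round_state_Cons[OF assms(2)] by blast
qed

lemma greedy_color_legal: "colorable G k h v \<Longrightarrow> legal_color G k h v (greedy_color G k h v)"
  unfolding colorable_def greedy_color_def by (rule LeastI_ex)

text \<open>A move changes the color of one vertex \<open>w\<close> only. There are no loops, so the
  legality check for \<open>w\<close> concerns other vertices; adjacency is symmetric, so the same
  check protects the neighbors of \<open>w\<close>.\<close>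

lemma greedy_play_proper:
  assumes "greedy_play G k \<sigma> h" "graph G" "map_of h v = Some c"
  shows "c \<in> {1..k} \<and> (\<forall>u. v \<rightarrow>\<^bsub>G\<^esub> u \<longrightarrow> map_of h u \<noteq> Some c)"
proof -
  interpret graph G by fact
  have step: "c \<in> {1..k} \<and> (\<forall>u. v \<rightarrow>\<^bsub>G\<^esub> u \<longrightarrow> map_of ((w, d) # h) u \<noteq> Some c)"
    if IH: "\<And>v c. map_of h v = Some c \<Longrightarrow>
          c \<in> {1..k} \<and> (\<forall>u. v \<rightarrow>\<^bsub>G\<^esub> u \<longrightarrow> map_of h u \<noteq> Some c)"
      and d: "legal_color G k h w d" and vc: "map_of ((w, d) # h) v = Some c"
    for h w d v c
  proof (cases "v = w")
    case True
    have "\<not> w \<rightarrow>\<^bsub>G\<^esub> w" by (auto dest: adj_not_same)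
    then show ?thesis using True d vc by (auto simp: legal_color_def)
  next
    case False
    have "w \<rightarrow>\<^bsub>G\<^esub> v" if "v \<rightarrow>\<^bsub>G\<^esub> w"
      using that arcs_ends_symmetric sym_arcs by metis
    then show ?thesis using False IH[of v c] d vc by (auto simp: legal_color_def)
  qed
  show ?thesis
    using assms(1,3)
  proof (induction arbitrary: v c)
    case start
    then show ?case by simp
  next
    case (alice h w d)
    show ?case by (rule step[OF alice.IH alice.hyps(5) alice.prems])
  next
    case (bob h w)
    show ?case by (rule step[OF bob.IH greedy_color_legal[OF bob.hyps(4)] bob.prems])
  qed
qed

text \<open>Against a winning strategy no play gets stuck: on her turn Alice has the prescribed
  move, and on Bob's turn every available vertex is colorable. The lower bounds use this to prolong
  plays without tracking whose turn it is.\<close>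

lemma winning_strategy_extend:
  assumes "winning_greedy_strategy G k \<sigma>" "greedy_play G k \<sigma> h"
    "finite (verts G)" "verts G \<noteq> {}"
  shows "\<exists>v c. greedy_play G k \<sigma> ((v, c) # h) \<and> available G h v \<and> legal_color G k h v c"
proof (cases "even (length h)")
  case True
  then have "case \<sigma> h of (v, c) \<Rightarrow> available G h v \<and> legal_color G k h v c"
    using assms unfolding winning_greedy_strategy_def by metis
  moreover obtain v c where vc: "\<sigma> h = (v, c)" by fastforce
  ultimately have "available G h v" "legal_color G k h v c" by simp_all
  then show ?thesis
    using greedy_play.alice[OF assms(2) True vc] by (intro exI conjI)
next
  case False
  obtain m S where rs: "round_state G h m S"
    using greedy_play_round_state[OF assms(2-4)] by blast
  then obtain v where "v \<in> verts G - S"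
    unfolding round_state_def by blast
  then have v: "available G h v"
    using available_round_state[OF rs] by blast
  then have "colorable G k h v"
    using False assms unfolding winning_greedy_strategy_def by metis
  then show ?thesis
    using greedy_play.bob[OF assms(2) False v] greedy_color_legal v by (intro exI conjI)
qed

lemma winning_strategy_first_round:
  assumes "winning_greedy_strategy G k \<sigma>" "finite (verts G)" "verts G \<noteq> {}"
  shows "\<exists>h. greedy_play G k \<sigma> h \<and> round_state G h 1 {} \<and> length h = card (verts G)
     \<and> (\<forall>v \<in> verts G. map_of h v \<noteq> None)"
proof -
  have "\<exists>h. greedy_play G k \<sigma> h \<and> length h = j" for j
  proof (induction j)
    case 0
    show ?case using greedy_play.start by blast
  next
    case (Suc j)
    then obtain h where "greedy_play G k \<sigma> h" "length h = j" by blast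
    then show ?case
      using winning_strategy_extend[OF assms(1) _ assms(2,3), of h] by (metis length_Cons)
  qed
  then obtain h where h: "greedy_play G k \<sigma> h" "length h = card (verts G)" by blast
  then obtain m S where mS: "round_state G h m S"
    using greedy_play_round_state[OF _ assms(2,3)] by blast
  then have S: "card S < card (verts G)" "finite S" and len: "card (verts G) = m * card (verts G) + card S"
    using h assms by (auto simp: round_state_def psubset_card_mono finite_subset)
  \<comment> \<open>The length equals \<open>card (verts G)\<close> while \<open>card S\<close> is
    smaller, so the play stands exactly at the end of the first round.\<close>
  have "m = 1"
  proof -
    have "m \<noteq> 0" using S len by (metis add_0 less_irrefl mult_0)
    moreover have "\<not> m \<ge> 2"
    proof
      assume "m \<ge> 2"
      then have "2 * card (verts G) \<le> m * card (verts G)" by simp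
      then show False using S len by linarith
    qed
    ultimately show ?thesis by linarith
  qed
  then have "S = {}" using S len by simp
  then have "round_state G h 1 {}" using mS \<open>m = 1\<close> by simp
  then show ?thesis
    using h by (auto simp: map_of_eq_None_iff_times_chosen round_state_def)
qed

text \<open>Replaces an explicit strategy by an invariant that some move of Alice and every greedy
  move of Bob preserve; the strategy then comes from the choice operator.\<close>

lemma alice_wins_greedyI:
  assumes "I []"
    and alice: "\<And>h. I h \<Longrightarrow> even (length h) \<Longrightarrow>
      \<exists>v c. available G h v \<and> legal_color G k h v c \<and> I ((v, c) # h)"
    and bob: "\<And>h v. I h \<Longrightarrow> odd (length h) \<Longrightarrow> available G h v \<Longrightarrow>
      colorable G k h v \<and> I ((v, greedy_color G k h v) # h)"
  shows "alice_wins_greedy G k"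
proof -
  define \<sigma> where "\<sigma> h = (SOME (v, c). available G h v \<and> legal_color G k h v c \<and> I ((v, c) # h))"
    for h
  have \<sigma>: "case \<sigma> h of (v, c) \<Rightarrow> available G h v \<and> legal_color G k h v c \<and> I ((v, c) # h)"
    if "I h" "even (length h)" for h
  proof -
    have "\<exists>p. case p of (v, c) \<Rightarrow> available G h v \<and> legal_color G k h v c \<and> I ((v, c) # h)"
      using alice[OF that] by auto
    then show ?thesis unfolding \<sigma>_def by (rule someI_ex)
  qed
  have I: "I h" if "greedy_play G k \<sigma> h" for h
    using that
  proof induction
    case start
    show ?case by fact
  next
    case (alice h v c)
    then show ?case using \<sigma>[of h] by simp
  next
    case (bob h v)
    then show ?case using assms(3) by blast
  qed
  have "winning_greedy_strategy G k \<sigma>"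
    unfolding winning_greedy_strategy_def
  proof (intro allI impI)
    fix h assume "greedy_play G k \<sigma> h"
    then have "I h" by (rule I)
    then show "if even (length h)
         then (case \<sigma> h of (v, c) \<Rightarrow> available G h v \<and> legal_color G k h v c)
         else (\<forall>v. available G h v \<longrightarrow> colorable G k h v)"
      using \<sigma>[of h] bob by (auto split: prod.splits)
  qed
  then show ?thesis unfolding alice_wins_greedy_def by blast
qed

text \<open>The entry \<open>None\<close> in a set of forbidden colors stands for an uncolored vertex.\<close>

definition first_fit :: "nat \<Rightarrow> nat option set \<Rightarrow> nat \<Rightarrow> bool" where
  "first_fit k F c \<longleftrightarrow>
     c \<in> {1..k} \<and> Some c \<notin> F \<and> (\<forall>d \<in> {1..k}. Some d \<notin> F \<longrightarrow> c \<le> d)"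

lemma first_fit_greedy:
  assumes "\<And>c. legal_color G k h v c \<longleftrightarrow> c \<in> {1..k} \<and> Some c \<notin> F" "first_fit k F c"
  shows "legal_color G k h v c" "colorable G k h v" "greedy_color G k h v = c"
  using assms unfolding colorable_def greedy_color_def first_fit_def
  by (auto intro!: Least_equality)

section \<open>Stars\<close>

locale star =
  fixes G :: "('a, 'b) pre_digraph" and z :: 'a and L :: "'a set"
  assumes graph: "graph G"
    and verts: "verts G = insert z L"
    and center: "z \<notin> L"
    and finite_leaves: "finite L"
    and leaves_nonempty: "L \<noteq> {}"
    and edges: "arcs_ends G = {z} \<times> L \<union> L \<times> {z}"
begin

lemma finite_verts: "finite (verts G)"
  by (simp add: verts finite_leaves)

lemma verts_nonempty: "verts G \<noteq> {}"
  by (simp add: verts)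

lemma card_verts: "card (verts G) = Suc (card L)"
  by (simp add: verts center finite_leaves)

lemma legal_color_leaf:
  "l \<in> L \<Longrightarrow> legal_color G k h l c \<longleftrightarrow>
     c \<in> {1..k} \<and> Some c \<notin> {map_of h z, map_of h l}"
  using center by (auto simp: legal_color_def edges)

lemma legal_color_center:
  "legal_color G k h z c \<longleftrightarrow> c \<in> {1..k} \<and> Some c \<notin> insert (map_of h z) (map_of h ` L)"
  using center by (auto simp: legal_color_def edges image_iff)

subsection \<open>Alice's strategy\<close>

text \<open>
  The relation \<open>start m x y\<close> admits center color \<open>x\<close> and common leaf color \<open>y\<close> at the start of round
  \<open>m\<close>. Once the center has its new color \<open>c\<close>, all leaves of old color \<open>y\<close> are bound to get color \<open>d\<close>.
\<close>

definition settled ::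
  "nat \<Rightarrow> (nat \<Rightarrow> nat option \<Rightarrow> nat option \<Rightarrow> bool) \<Rightarrow> nat \<Rightarrow> nat option \<Rightarrow> nat \<Rightarrow> nat \<Rightarrow> bool" where
  "settled k start m y c d \<longleftrightarrow> first_fit k {Some c, y} d \<and> start (Suc m) (Some c) (Some d)"

definition round_start where
  "round_start start h m S \<longleftrightarrow>
     S = {} \<and> (\<exists>x y. map_of h z = x \<and> (\<forall>l \<in> L. map_of h l = y) \<and> start m x y)"

definition center_chosen where
  "center_chosen k start h m S \<longleftrightarrow> z \<in> S \<and>
     (\<exists>c y d. map_of h z = Some c \<and> (\<forall>l \<in> L. map_of h l = (if l \<in> S then Some d else y)) \<and>
        settled k start m y c d)"

text \<open>This state arises only from Bob opening with a leaf. The parity condition puts Alice on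
  turn, and \<open>c\<close> is the color kept free for her reply at the center, chosen so that the
  other leaves must then follow the first one.\<close>

definition leaf_first where
  "leaf_first k start h m S \<longleftrightarrow> odd (m * card (verts G)) \<and>
     (\<exists>l \<in> L. S = {l} \<and> (\<exists>x y c d. map_of h z = x \<and> map_of h l = Some d \<and>
        (\<forall>l' \<in> L - {l}. map_of h l' = y) \<and>
        c \<in> {1..k} \<and> Some c \<notin> {x, y, Some d} \<and> settled k start m y c d))"

definition invariant where
  "invariant k start h \<longleftrightarrow> (\<exists>m S. round_state G h m S \<and>
     (round_start start h m S \<or> center_chosen k start h m S \<or> leaf_first k start h m S))"

lemma invariant_settled:
  assumes rs: "round_state G ((v, a) # h) m S \<or> S = verts G \<and> round_state G ((v, a) # h) (Suc m) {}"
    and "z \<in> S" "map_of ((v, a) # h) z = Some c"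
    and "\<And>l. l \<in> L \<Longrightarrow> map_of ((v, a) # h) l = (if l \<in> S then Some d else y)"
    and "settled k start m y c d"
  shows "invariant k start ((v, a) # h)"
  using rs
proof
  assume "round_state G ((v, a) # h) m S"
  moreover have "center_chosen k start ((v, a) # h) m S"
    using assms(2-) unfolding center_chosen_def by blast
  ultimately show ?thesis unfolding invariant_def by blast
next
  assume S: "S = verts G \<and> round_state G ((v, a) # h) (Suc m) {}"
  have "start (Suc m) (Some c) (Some d)"
    using assms(5) by (simp add: settled_def)
  moreover have "\<forall>l \<in> L. map_of ((v, a) # h) l = Some d"
    using assms(4) S verts by simp
  ultimately have "round_start start ((v, a) # h) (Suc m) {}"
    using assms(3) unfolding round_start_def by blast
  then show ?thesis using S unfolding invariant_def by blast
qed

lemma invariant_center_first: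
  assumes "round_state G h m {}" "map_of h z = x" "\<forall>l \<in> L. map_of h l = y" "settled k start m y c d"
  shows "invariant k start ((z, c) # h)"
proof (rule invariant_settled[OF round_state_Cons[OF finite_verts]])
  show "map_of ((z, c) # h) l = (if l \<in> {z} then Some d else y)" if "l \<in> L" for l
    using that assms center by auto
qed (use assms verts in auto)

text \<open>Only leaves of old color \<open>y\<close> remain, and the center keeps color
  \<open>c\<close>, so the greedy color is \<open>d\<close>. The same move serves both players, so
  it does not matter who is on turn.\<close>

lemma invariant_center_chosen:
  assumes rs: "round_state G h m S" and cc: "center_chosen k start h m S" and v: "v \<in> verts G - S"
  shows "colorable G k h v \<and> legal_color G k h v (greedy_color G k h v)
     \<and> invariant k start ((v, greedy_color G k h v) # h)"
proof -
  obtain c y d where zS: "z \<in> S" and z: "map_of h z = Some c"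
    and L: "\<And>l. l \<in> L \<Longrightarrow> map_of h l = (if l \<in> S then Some d else y)"
    and s: "settled k start m y c d"
    using cc unfolding center_chosen_def by blast
  have vL: "v \<in> L" "v \<noteq> z" "v \<notin> S" using v zS verts by auto
  have ff: "first_fit k {Some c, y} d" using s by (simp add: settled_def)
  have "legal_color G k h v e \<longleftrightarrow> e \<in> {1..k} \<and> Some e \<notin> {Some c, y}" for e
    using legal_color_leaf[OF vL(1)] z L vL by simp
  note greedy = first_fit_greedy[OF this ff]
  have "invariant k start ((v, d) # h)"
    by (rule invariant_settled[OF round_state_Cons[OF finite_verts rs v] _ _ _ s]) (use zS z L vL in auto)
  then show ?thesis using greedy by simp
qed

text \<open>Reduces the game to conditions on the colors at the start of a round. The number of
  moves before round \<open>m\<close> is \<open>m * card (verts G)\<close>, so its parity tells who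
  opens the round.\<close>

lemma alice_wins_star:
  assumes init: "start 0 None None"
    and alice: "\<And>m x y. start m x y \<Longrightarrow> even (m * card (verts G)) \<Longrightarrow>
      \<exists>c d. c \<in> {1..k} \<and> Some c \<notin> {x, y} \<and> settled k start m y c d"
    and bob_center: "\<And>m x y. start m x y \<Longrightarrow> odd (m * card (verts G)) \<Longrightarrow>
      \<exists>c d. first_fit k {x, y} c \<and> settled k start m y c d"
    and bob_leaf: "\<And>m x y. start m x y \<Longrightarrow> odd (m * card (verts G)) \<Longrightarrow>
      \<exists>c d. first_fit k {x, y} d \<and> c \<in> {1..k} \<and> Some c \<notin> {x, y, Some d} \<and>
        settled k start m y c d"
  shows "alice_wins_greedy G k"
proof (rule alice_wins_greedyI[where I = "invariant k start"])
  have "round_start start [] 0 {}"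
    using init unfolding round_start_def by (intro conjI exI[of _ None]) simp_all
  then show "invariant k start []"
    using round_state_Nil[OF verts_nonempty] unfolding invariant_def by blast
next
  fix h assume "invariant k start h" and ev: "even (length h)"
  then obtain m S where rs: "round_state G h m S"
    and cases: "round_start start h m S \<or> center_chosen k start h m S \<or> leaf_first k start h m S"
    unfolding invariant_def by blast
  note av = available_round_state[OF rs]
  have len: "length h = m * card (verts G) + card S" using rs by (simp add: round_state_def)
  from cases show "\<exists>v c. available G h v \<and> legal_color G k h v c \<and> invariant k start ((v, c) # h)"
  proof (elim disjE)
    assume "round_start start h m S"
    then obtain x y where S: "S = {}" and xy: "map_of h z = x" "\<forall>l \<in> L. map_of h l = y" "start m x y"
      unfolding round_start_def by blast
    obtain c d where c: "c \<in> {1..k}" "Some c \<notin> {x, y}" and s: "settled k start m y c d"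
      using alice[OF xy(3)] ev len S by auto
    have "legal_color G k h z c"
      using c xy by (auto simp: legal_color_center)
    moreover have "invariant k start ((z, c) # h)"
      using invariant_center_first rs S xy s by blast
    moreover have "available G h z" using av S verts by simp
    ultimately show ?thesis by blast
  next
    assume cc: "center_chosen k start h m S"
    obtain v where "v \<in> verts G - S" using rs by (auto simp: round_state_def)
    then show ?thesis using invariant_center_chosen[OF rs cc] av by blast
  next
    assume "leaf_first k start h m S"
    then obtain l x y c d where l: "l \<in> L" "S = {l}" and h: "map_of h z = x" "map_of h l = Some d"
        "\<forall>l' \<in> L - {l}. map_of h l' = y"
      and c: "c \<in> {1..k}" "Some c \<notin> {x, y, Some d}" and s: "settled k start m y c d"
      unfolding leaf_first_def by blast
    have zS: "z \<in> verts G - S" using l center verts by auto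
    have "legal_color G k h z c"
      using c h by (auto simp: legal_color_center)
    moreover have "invariant k start ((z, c) # h)"
      by (rule invariant_settled[OF round_state_Cons[OF finite_verts rs zS] _ _ _ s])
        (use h l center in auto)
    ultimately show ?thesis using av zS by blast
  qed
next
  fix h v assume "invariant k start h" and od: "odd (length h)" and "available G h v"
  then obtain m S where rs: "round_state G h m S"
    and cases: "round_start start h m S \<or> center_chosen k start h m S \<or> leaf_first k start h m S"
    unfolding invariant_def by blast
  have v: "v \<in> verts G - S"
    using available_round_state[OF rs] \<open>available G h v\<close> by blast
  have len: "length h = m * card (verts G) + card S" using rs by (simp add: round_state_def)
  from cases show "colorable G k h v \<and> invariant k start ((v, greedy_color G k h v) # h)"
  proof (elim disjE)
    assume "round_start start h m S"
    then obtain x y where S: "S = {}" and xy: "map_of h z = x" "\<forall>l \<in> L. map_of h l = y" "start m x y"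
      unfolding round_start_def by blast
    have odm: "odd (m * card (verts G))" using od len S by simp
    show ?thesis
    proof (cases "v = z")
      case True
      obtain c d where c: "first_fit k {x, y} c" and s: "settled k start m y c d"
        using bob_center[OF xy(3) odm] by auto
      \<comment> \<open>Without a leaf, \<open>y\<close> would not be forbidden for the
        center.\<close>
      have "map_of h ` L = {y}" using xy(2) leaves_nonempty by auto
      then have "legal_color G k h v e \<longleftrightarrow> e \<in> {1..k} \<and> Some e \<notin> {x, y}" for e
        using xy True by (simp add: legal_color_center)
      note greedy = first_fit_greedy[OF this c]
      have "invariant k start ((z, c) # h)"
        using invariant_center_first rs S xy s by blast
      then show ?thesis using greedy True by simp
    next
      case False
      then have vL: "v \<in> L" using v verts by auto
      obtain c d where d: "first_fit k {x, y} d" and c: "c \<in> {1..k}" "Some c \<notin> {x, y, Some d}"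
        and s: "settled k start m y c d"
        using bob_leaf[OF xy(3) odm] by auto
      have "legal_color G k h v e \<longleftrightarrow> e \<in> {1..k} \<and> Some e \<notin> {x, y}" for e
        using legal_color_leaf[OF vL] xy vL by simp
      note greedy = first_fit_greedy[OF this d]
      have "insert v S \<noteq> verts G" using S False verts by auto
      then have "round_state G ((v, d) # h) m {v}"
        using round_state_Cons[OF finite_verts rs v] S by auto
      moreover have "leaf_first k start ((v, d) # h) m {v}"
        unfolding leaf_first_def
        by (intro conjI bexI[OF _ vL] exI[of _ x] exI[of _ y] exI[of _ c] exI[of _ d])
          (use odm c s xy vL False in auto)
      ultimately have "invariant k start ((v, d) # h)"
        unfolding invariant_def by blast
      then show ?thesis using greedy by simp
    qed
  next
    assume "center_chosen k start h m S"
    then show ?thesis using invariant_center_chosen[OF rs _ v] by blast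
  next
    assume "leaf_first k start h m S"
    \<comment> \<open>One move after an odd number of moves makes the length even, so Bob is not on
      turn.\<close>
    then show ?thesis using od len unfolding leaf_first_def by auto
  qed
qed

section \<open>Upper bounds: three colors for odd stars, four for even ones\<close>

lemma alice_wins_star_odd:
  assumes "odd (card L)"
  shows "alice_wins_greedy G 3"
proof -
  define start :: "nat \<Rightarrow> nat option \<Rightarrow> nat option \<Rightarrow> bool" where
    "start = (\<lambda>m x y. x = None \<and> y = None \<or>
       (\<exists>a b. x = Some a \<and> y = Some b \<and> {a, b} \<subseteq> {1..3} \<and> a \<noteq> b))"
  have three: "{1..3} = {1, 2, 3::nat}" by auto
  show ?thesis
  proof (rule alice_wins_star[where start = start])
    show "start 0 None None" by (simp add: start_def)
    show "\<exists>c d. c \<in> {1..3} \<and> Some c \<notin> {x, y} \<and> settled 3 start m y c d"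
      if st: "start m x y" for m x y
    proof (cases "x = None")
      case True
      then have "first_fit 3 {Some 3, y} 1" "y = None"
        using st by (auto simp: start_def first_fit_def)
      then show ?thesis using True
        by (intro exI[of _ 3] exI[of _ 1]) (auto simp: settled_def start_def)
    next
      case False
      then obtain a b where ab: "x = Some a" "y = Some b" "{a, b} \<subseteq> {1..3}" "a \<noteq> b"
        using st unfolding start_def by blast
      then have "a \<in> {1, 2, 3}" "b \<in> {1, 2, 3}" unfolding three by auto
      \<comment> \<open>The colors sum to 6, so \<open>6 - a - b\<close> is the third one; once the
        center has it, leaves of color \<open>b\<close> can only get \<open>a\<close>.\<close>
      with ab have "first_fit 3 {Some (6 - a - b), y} a" "6 - a - b \<in> {1..3}" "6 - a - b \<notin> {a, b}"
        unfolding first_fit_def three by auto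
      then show ?thesis using ab
        by (intro exI[of _ "6 - a - b"] exI[of _ a]) (auto simp: settled_def start_def)
    qed
  \<comment> \<open>The number of vertices is even, so the two conditions on rounds opened by Bob
    are vacuous.\<close>
  qed (use assms card_verts in auto)
qed

lemma alice_wins_star_even:
  assumes "even (card L)"
  shows "alice_wins_greedy G 4"
proof -
  define start :: "nat \<Rightarrow> nat option \<Rightarrow> nat option \<Rightarrow> bool" where
    "start = (\<lambda>m x y. m = 0 \<and> x = None \<and> y = None \<or>
       x \<in> {Some 3, Some 4} \<and> y \<in> {Some 1, Some 2} \<or>
       even m \<and> x \<in> {Some 1, Some 2} \<and> y = Some 3)"
  have four: "{1..4} = {1, 2, 3, 4::nat}" by auto
  have parity: "even (m * card (verts G)) \<longleftrightarrow> even m" for m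
    using assms card_verts by simp
  show ?thesis
  proof (rule alice_wins_star[where start = start])
    show "start 0 None None" by (simp add: start_def)
    show "\<exists>c d. c \<in> {1..4} \<and> Some c \<notin> {x, y} \<and> settled 4 start m y c d"
      if "start m x y" for m x y
    proof -
      define c :: nat where "c = (if x = Some 4 then 3 else 4)"
      define d :: nat where "d = (if y = Some 1 then 2 else 1)"
      show ?thesis
        using that
        by (intro exI[of _ c] exI[of _ d])
          (auto simp: start_def settled_def first_fit_def four c_def d_def)
    qed
    show "\<exists>c d. first_fit 4 {x, y} c \<and> settled 4 start m y c d"
      if "start m x y" "odd (m * card (verts G))" for m x y
    proof -
      define c :: nat where "c = (if y = Some 1 then 2 else 1)"
      show ?thesis
        using that parity
        by (intro exI[of _ c] exI[of _ 3])
          (auto simp: start_def settled_def first_fit_def four c_def)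
    qed
    show "\<exists>c d. first_fit 4 {x, y} d \<and> c \<in> {1..4} \<and> Some c \<notin> {x, y, Some d} \<and>
        settled 4 start m y c d"
      if "start m x y" "odd (m * card (verts G))" for m x y
    proof -
      define c :: nat where "c = (if x = Some 4 then 3 else 4)"
      define d :: nat where "d = (if y = Some 1 then 2 else 1)"
      show ?thesis
        using that parity
        by (intro exI[of _ c] exI[of _ d])
          (auto simp: start_def settled_def first_fit_def four c_def d_def)
    qed
  qed
qed

subsection \<open>Bob's strategy\<close>

lemma alice_wins_star_ge_3:
  assumes "alice_wins_greedy G k"
  shows "k \<ge> 3"
proof -
  obtain \<sigma> where \<sigma>: "winning_greedy_strategy G k \<sigma>"
    using assms by (auto simp: alice_wins_greedy_def)
  obtain h where h: "greedy_play G k \<sigma> h" and col: "\<forall>v \<in> verts G. map_of h v \<noteq> None"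
    using winning_strategy_first_round[OF \<sigma> finite_verts verts_nonempty] by blast
  obtain v c where v: "available G h v" and c: "legal_color G k h v c"
    using winning_strategy_extend[OF \<sigma> h finite_verts verts_nonempty] by blast
  have "v \<in> verts G" using v by (simp add: available_def)
  then obtain u where u: "v \<rightarrow>\<^bsub>G\<^esub> u" "u \<in> verts G"
    using verts edges leaves_nonempty by auto
  obtain a b where ab: "map_of h v = Some a" "map_of h u = Some b"
    using col u \<open>v \<in> verts G\<close> by blast
  have "{a, b, c} \<subseteq> {1..k}"
    using greedy_play_proper[OF h graph] ab c by (auto simp: legal_color_def)
  moreover have "card {a, b, c} = 3"
  proof -
    have "a \<noteq> b" "a \<noteq> c" "b \<noteq> c"
      using greedy_play_proper[OF h graph ab(1)] ab u c by (auto simp: legal_color_def)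
    then show ?thesis by simp
  qed
  ultimately show ?thesis
    using card_mono[OF finite_atLeastAtMost, of "{a, b, c}" 1 k]
    unfolding card_atLeastAtMost by linarith
qed

text \<open>With three colors the center is stuck as soon as the leaves carry two colors. Bob brings this
  about in round 2, where he moves first: he recolors a leaf, whereupon Alice must choose a leaf
  too, and a third leaf still has its old color.\<close>

lemma alice_wins_star_ge_4:
  assumes "alice_wins_greedy G k" "even (card L)" "card L \<ge> 4"
  shows "k \<ge> 4"
proof (rule ccontr)
  assume "\<not> k \<ge> 4"
  then have "k = 3" using alice_wins_star_ge_3[OF assms(1)] by linarith
  then have k: "{1..k} = {1, 2, 3}" by auto
  obtain \<sigma> where \<sigma>: "winning_greedy_strategy G k \<sigma>"
    using assms by (auto simp: alice_wins_greedy_def)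
  obtain h where h: "greedy_play G k \<sigma> h" and rs: "round_state G h 1 {}"
    and len: "length h = card (verts G)" and col: "\<forall>v \<in> verts G. map_of h v \<noteq> None"
    using winning_strategy_first_round[OF \<sigma> finite_verts verts_nonempty] by blast
  have odd: "odd (length h)" using len card_verts assms by simp
  have stuck: "\<not> legal_color G k h' z e"
    if "greedy_play G k \<sigma> h'" "map_of h' z = Some x" "l \<in> L" "l' \<in> L"
      "map_of h' l = Some b" "map_of h' l' = Some d" "b \<noteq> d" for h' e x l l' b d
  proof -
    have "z \<rightarrow>\<^bsub>G\<^esub> l" "z \<rightarrow>\<^bsub>G\<^esub> l'" using that edges by auto
    then have "x \<noteq> b" "x \<noteq> d"
      using greedy_play_proper[OF that(1) graph that(2)] that(5,6) by auto
    moreover have "{x, b, d} \<subseteq> {1..k}"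
      using greedy_play_proper[OF that(1) graph] that(2,5,6) by auto
    moreover have "card {x, b, d} = card {1..k}"
      using \<open>x \<noteq> b\<close> \<open>x \<noteq> d\<close> \<open>b \<noteq> d\<close> unfolding k by simp
    ultimately have "{1..k} = {x, b, d}"
      using card_subset_eq[of "{1..k}" "{x, b, d}"] by simp
    moreover have "{Some x, Some b, Some d} \<subseteq> insert (map_of h' z) (map_of h' ` L)"
      using that(2) imageI[OF that(3), of "map_of h'"] imageI[OF that(4), of "map_of h'"]
      unfolding that(5,6) by simp
    ultimately show ?thesis
      unfolding legal_color_center by blast
  qed
  have bob: "colorable G k h' v"
    if "greedy_play G k \<sigma> h'" "odd (length h')" "available G h' v" for h' v
    using \<sigma> that unfolding winning_greedy_strategy_def by metis
  have z: "z \<in> verts G" using verts by simp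
  have L: "l \<in> verts G" if "l \<in> L" for l
    using that verts by simp
  obtain l where l: "l \<in> L" using leaves_nonempty by blast
  obtain x where x: "map_of h z = Some x" using col z by blast
  obtain b where b: "map_of h l = Some b" using col L[OF l] by blast
  have avail: "available G h v" if "v \<in> verts G" for v
    using available_round_state[OF rs] that by simp
  have mono: "map_of h l' = Some b" if l': "l' \<in> L" for l'
  proof (rule ccontr)
    assume neq: "map_of h l' \<noteq> Some b"
    obtain e where e: "map_of h l' = Some e" using col L[OF l'] by blast
    then have "b \<noteq> e" using neq by simp
    moreover obtain c where "legal_color G k h z c"
      using bob[OF h odd avail[OF z]] unfolding colorable_def by blast
    ultimately show False
      using stuck[OF h x l l' b e] by blast
  qed
  define d where "d = greedy_color G k h l"
  define h1 where "h1 = (l, d) # h"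
  note l_col = bob[OF h odd avail[OF L[OF l]]]
  have h1: "greedy_play G k \<sigma> h1"
    unfolding h1_def d_def by (rule greedy_play.bob[OF h odd avail[OF L[OF l]] l_col])
  have d: "d \<noteq> b"
    using greedy_color_legal[OF l_col] b unfolding legal_color_def d_def by metis
  have zl: "z \<noteq> l" using l center by blast
  have rs1: "round_state G h1 1 {l}"
    using round_state_Cons[OF finite_verts rs, of l d] L[OF l] z zl unfolding h1_def by auto
  obtain v c where h2: "greedy_play G k \<sigma> ((v, c) # h1)" and v: "available G h1 v"
    and c: "legal_color G k h1 v c"
    using winning_strategy_extend[OF \<sigma> h1 finite_verts verts_nonempty] by blast
  have other: "\<exists>w \<in> L. w \<noteq> l \<and> w \<noteq> u" for u
  proof (rule ccontr)
    assume "\<not> ?thesis"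
    then have "L \<subseteq> {l, u}" by blast
    then have "card L \<le> card {l, u}" by (intro card_mono) auto
    also have "\<dots> \<le> 2" by (simp add: card_insert_if)
    finally show False using assms(3) by simp
  qed
  have h1_col: "map_of h1 z = Some x" "map_of h1 l = Some d"
    and h1_leaf: "map_of h1 w = Some b" if "w \<in> L" "w \<noteq> l" for w
    using x zl mono that by (auto simp: h1_def)
  obtain w where w: "w \<in> L" "w \<noteq> l" "w \<noteq> v" using other by blast
  have "v \<noteq> z"
    using stuck[OF h1 h1_col(1) l w(1) h1_col(2) h1_leaf d] w c by blast
  moreover have v_new: "v \<in> verts G - {l}"
    using v available_round_state[OF rs1] by blast
  ultimately have "round_state G ((v, c) # h1) 1 {v, l}" and zv: "z \<in> verts G - {v, l}"
    using round_state_Cons[OF finite_verts rs1 v_new, of c] z zl by auto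
  then have "available G ((v, c) # h1) z"
    using available_round_state[of G "(v, c) # h1" 1 "{v, l}"] by blast
  then have "colorable G k ((v, c) # h1) z"
    using bob[OF h2] odd by (simp add: h1_def)
  moreover have "map_of ((v, c) # h1) z = Some x" "map_of ((v, c) # h1) l = Some d"
      "map_of ((v, c) # h1) w = Some b"
    using h1_col h1_leaf w zv v_new by auto
  ultimately show False
    using stuck[OF h2 _ l w(1) _ _ d] unfolding colorable_def by blast
qed

end

lemma star_exists:
  assumes "n \<ge> 1" "K\<^bsub>1,n\<^esub> G"
  shows "\<exists>z L. star G z L \<and> card L = n"
proof -
  obtain U V where UV: "graph G" "verts G = U \<union> V" "U \<inter> V = {}" "card U = 1" "card V = n"
    "arcs_ends G = U \<times> V \<union> V \<times> U"
    using assms unfolding complete_bipartite_digraph_def by blast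
  obtain z where "U = {z}" using UV(4) card_1_singletonE by blast
  moreover have "finite V" "V \<noteq> {}"
    using UV(5) assms(1) by (auto intro: card_ge_0_finite)
  ultimately have "star G z V"
    using UV(1-3,6) by (intro star.intro) simp_all
  then show ?thesis using UV by blast
qed

theorem theorem4p2:
  fixes n :: nat and G :: "('a, 'b) pre_digraph"
  assumes "n \<ge> 1" and "K\<^bsub>1,n\<^esub> G"
  shows "(odd n \<longrightarrow> \<chi>\<^sub>g\<^sup>\<infinity>\<^sup>2 G = 3) \<and> (even n \<and> n \<ge> 4 \<longrightarrow> \<chi>\<^sub>g\<^sup>\<infinity>\<^sup>2 G = 4)"
proof -
  obtain z L where "star G z L" and n: "card L = n"
    using star_exists[OF assms] by blast
  then interpret star G z L by blast
  show ?thesis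
    unfolding eternal_greedy_game_chromatic_number_def
    using alice_wins_star_odd alice_wins_star_even alice_wins_star_ge_3 alice_wins_star_ge_4 n
    by (auto intro!: Least_equality)
qed

end
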